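(* Let $N\in\{2,3,5\}$ and let $B\subset\mathbb{Z}$ be a set with $|B|=N$ and $0\in B$. Then $B$ is spectral if and only if $B=N^kB_0$, where $k$ is a nonnegative integer and $B_0$ is a complete set of residues modulo $N$.
   Context: A finite set $B\subset\mathbb{R}$ is spectral if there exists a set $\Lambda\subset\mathbb{R}$ such that $\{e^{2\pi i\lambda x}:\lambda\in\Lambda\}$ is an orthogonal basis of $L^2$ of the counting measure on $B$. A complete set of residues modulo $N$ is a set of $N$ integers that are pairwise incongruent modulo $N$, and $N^kB_0=\{N^kb:b\in B_0\}$. *)

theory Defs
  imports "HOL-Analysis.Analysis" "HOL-Library.Function_Algebras" "HOL-Number_Theory.Cong"
begin

(* Functions are identified when they agree almost everywhere, i.e. on B; the
   representative vanishing outside B is used as the canonical one. *)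
definition L2_count :: "real set \<Rightarrow> (real \<Rightarrow> complex) set" where
  "L2_count B = {f. (\<forall>x. x \<notin> B \<longrightarrow> f x = 0) \<and> integrable (count_space B) (\<lambda>x. (norm (f x))\<^sup>2)}"

definition L2_inner :: "real set \<Rightarrow> (real \<Rightarrow> complex) \<Rightarrow> (real \<Rightarrow> complex) \<Rightarrow> complex" where
  "L2_inner B f g = (LINT x|count_space B. f x * cnj (g x))"

definition fscale :: "complex \<Rightarrow> (real \<Rightarrow> complex) \<Rightarrow> real \<Rightarrow> complex" where
  "fscale c f = (\<lambda>x. c * f x)"

lemma vector_space_fscale: "vector_space fscale"
  by unfold_locales (auto simp: fscale_def fun_eq_iff algebra_simps)

(* Intended for finite B: the space is then finite-dimensional, so the algebraic
   complex span is already closed. *)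
definition orthogonal_basis_L2 :: "real set \<Rightarrow> (real \<Rightarrow> complex) set \<Rightarrow> bool" where
  "orthogonal_basis_L2 B S \<longleftrightarrow>
     S \<subseteq> L2_count B \<and> 0 \<notin> S \<and>
     pairwise (\<lambda>f g. L2_inner B f g = 0) S \<and>
     module.span fscale S = L2_count B"

definition exponential_on :: "real set \<Rightarrow> real \<Rightarrow> real \<Rightarrow> complex" where
  "exponential_on B l =
     (\<lambda>x. if x \<in> B then exp (2 * of_real pi * \<i> * of_real l * of_real x) else 0)"

definition spectral :: "real set \<Rightarrow> bool" where
  "spectral B \<longleftrightarrow> finite B \<and> (\<exists>\<Lambda> :: real set. orthogonal_basis_L2 B (exponential_on B ` \<Lambda>))"

definition complete_residue_set :: "nat \<Rightarrow> int set \<Rightarrow> bool" where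
  "complete_residue_set N R \<longleftrightarrow>
     finite R \<and> card R = N \<and> pairwise (\<lambda>a b. \<not> [a = b] (mod int N)) R"

end

(* For the forward direction it is enough to find a real t such that the numbers exp(2 pi i t b),
   b in B, are the N distinct N-th roots of unity: then N t b is an integer c_b, the c_b form a
   complete set of residues, and b c_a = a c_b shows that all nonzero b in B are divisible by the
   same power of N.  One takes for t the difference of two frequencies.  For N = 2, 3 a vanishing sum
   of N unimodular numbers, one of which is 1, consists of the N-th roots of unity.  For N = 5 one
   also needs that the sum of the squares vanishes.  Some pair of frequencies achieves this: the
   exponentials form a complex 5 x 5 Hadamard matrix with rows h_p, and as each family (h_q h_s)_s is
   again an orthogonal basis of C^5, the squared inner products of the vectors h_p h_r satisfy
   enough quadratic relations to force <h_p^2, h_q^2> = 0 for some p, q with p different from q. *)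

theory Submission
  imports Defs
begin

section \<open>Hadamard matrices of order five\<close>

text \<open>If the \<open>b\<^sub>i\<close> differ from \<open>1\<close>, the relations say that any two of the three ratios
  \<open>a\<^sub>i / (1 - b\<^sub>i)\<close> add up to \<open>1\<close>.\<close>

lemma half_of_relations:
  fixes a\<^sub>1 a\<^sub>2 a\<^sub>3 b\<^sub>1 b\<^sub>2 b\<^sub>3 :: real
  assumes "(1 - a\<^sub>1 - b\<^sub>1) * (1 - a\<^sub>2 - b\<^sub>2) = a\<^sub>1 * a\<^sub>2"
    and "(1 - a\<^sub>1 - b\<^sub>1) * (1 - a\<^sub>3 - b\<^sub>3) = a\<^sub>1 * a\<^sub>3"
    and "(1 - a\<^sub>2 - b\<^sub>2) * (1 - a\<^sub>3 - b\<^sub>3) = a\<^sub>2 * a\<^sub>3"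
    and "b\<^sub>1 \<noteq> 1" "b\<^sub>2 \<noteq> 1" "b\<^sub>3 \<noteq> 1"
  shows "2 * a\<^sub>1 + b\<^sub>1 = 1"
proof -
  have *: "a / (1 - b) + c / (1 - d) = 1"
    if "(1 - a - b) * (1 - c - d) = a * c" "b \<noteq> 1" "d \<noteq> 1" for a b c d :: real
  proof -
    have "a * (1 - d) + c * (1 - b) = (1 - b) * (1 - d)" using that(1) by algebra
    then show ?thesis using that(2,3) by (simp add: add_frac_eq)
  qed
  have "2 * (a\<^sub>1 / (1 - b\<^sub>1)) = 1"
    using *[OF assms(1,4,5)] *[OF assms(2,4,6)] *[OF assms(3,5,6)] by linarith
  then show ?thesis using \<open>b\<^sub>1 \<noteq> 1\<close> by (simp add: field_simps)
qed

lemma mult_cnj_unit: "norm (z :: complex) = 1 \<Longrightarrow> z * cnj z = 1"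
  by (simp add: complex_norm_square[symmetric])

text \<open>Complex Hadamard matrices of order five, with rows \<open>h p\<close>. The index types
  stay abstract because later the rows are indexed by basis functions and the columns by points of
  the set.\<close>

locale hadamard5 =
  fixes I :: "'r set" and J :: "'c set" and h :: "'r \<Rightarrow> 'c \<Rightarrow> complex"
  assumes card_I: "card I = 5" and card_J: "card J = 5"
    and norm_h: "\<And>p j. p \<in> I \<Longrightarrow> j \<in> J \<Longrightarrow> norm (h p j) = 1"
    and row_orth: "\<And>p q. p \<in> I \<Longrightarrow> q \<in> I \<Longrightarrow> p \<noteq> q \<Longrightarrow> (\<Sum>j\<in>J. h p j * cnj (h q j)) = 0"
    and col_orth: "\<And>j k. j \<in> J \<Longrightarrow> k \<in> J \<Longrightarrow>
      (\<Sum>p\<in>I. h p j * cnj (h p k)) = (if j = k then 5 else 0)"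
begin

lemma finite_I: "finite I" and finite_J: "finite J"
  using card_I card_J by (auto intro: card_ge_0_finite)

lemma h_cnj: "p \<in> I \<Longrightarrow> j \<in> J \<Longrightarrow> h p j * cnj (h p j) = 1"
  using norm_h by (simp add: mult_cnj_unit)

text \<open>Exchanging the sums leaves inner products of columns, which \<open>col_orth\<close>
  evaluates; this is Parseval's identity for the basis of conjugated rows.\<close>

lemma parseval:
  "(\<Sum>r\<in>I. (\<Sum>j\<in>J. F j * h r j) * cnj (\<Sum>k\<in>J. G k * h r k)) = 5 * (\<Sum>j\<in>J. F j * cnj (G j))"
proof -
  have "(\<Sum>r\<in>I. (\<Sum>j\<in>J. F j * h r j) * cnj (\<Sum>k\<in>J. G k * h r k))
      = (\<Sum>r\<in>I. \<Sum>j\<in>J. \<Sum>k\<in>J. F j * cnj (G k) * (h r j * cnj (h r k)))"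
    by (simp add: sum_product mult_ac)
  also have "\<dots> = (\<Sum>j\<in>J. \<Sum>r\<in>I. \<Sum>k\<in>J. F j * cnj (G k) * (h r j * cnj (h r k)))"
    by (rule sum.swap)
  also have "\<dots> = (\<Sum>j\<in>J. \<Sum>k\<in>J. \<Sum>r\<in>I. F j * cnj (G k) * (h r j * cnj (h r k)))"
    by (intro sum.cong refl sum.swap)
  also have "\<dots> = (\<Sum>j\<in>J. \<Sum>k\<in>J. F j * cnj (G k) * (if j = k then 5 else 0))"
    by (simp add: sum_distrib_left[symmetric] col_orth)
  also have "\<dots> = (\<Sum>j\<in>J. F j * cnj (G j) * 5)"
    by (simp add: if_distrib sum.delta' finite_J cong: if_cong)
  finally show ?thesis by (simp add: sum_distrib_left mult_ac)
qed

text \<open>Inner products of the vectors \<open>h\<^sub>p h\<^sub>r\<close> and \<open>h\<^sub>q h\<^sub>s\<close>, where products of rows are entrywise;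
  \<open>wt\<close> normalises their squared absolute values by \<open>5\<^sup>2\<close>.\<close>

definition corr :: "'r \<Rightarrow> 'r \<Rightarrow> 'r \<Rightarrow> 'r \<Rightarrow> complex" where
  "corr p r q s = (\<Sum>j\<in>J. h p j * h r j * cnj (h q j * h s j))"

definition wt :: "'r \<Rightarrow> 'r \<Rightarrow> 'r \<Rightarrow> 'r \<Rightarrow> real" where
  "wt p r q s = (norm (corr p r q s))\<^sup>2 / 25"

section \<open>Symmetries and orthogonality relations of the correlations\<close>

lemma wt_nonneg: "0 \<le> wt p r q s"
  by (simp add: wt_def)

lemma corr_cnj: "corr q s p r = cnj (corr p r q s)"
  by (simp add: corr_def mult_ac)

lemma wt_swap: "wt q s p r = wt p r q s"
  by (simp add: wt_def corr_cnj[of q s])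

lemma wt_commL: "wt r p q s = wt p r q s"
  by (simp add: wt_def corr_def mult_ac)

lemma wt_commR: "wt p r s q = wt p r q s"
  by (simp add: wt_def corr_def mult_ac)

text \<open>The shared row \<open>p\<close> cancels because its entries are unimodular; what remains
  is the inner product of the distinct rows \<open>r\<close> and \<open>q\<close>.\<close>

lemma corr_common:
  assumes "p \<in> I" "q \<in> I" "r \<in> I" "r \<noteq> q"
  shows "corr r p q p = 0" "corr r p p q = 0"
proof -
  have "corr r p q p = (\<Sum>j\<in>J. h r j * cnj (h q j))"
    unfolding corr_def
  proof (intro sum.cong refl)
    fix j assume "j \<in> J"
    have "h r j * h p j * cnj (h q j * h p j) = (h p j * cnj (h p j)) * (h r j * cnj (h q j))"
      by (simp add: mult_ac)
    then show "h r j * h p j * cnj (h q j * h p j) = h r j * cnj (h q j)"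
      using h_cnj[OF assms(1) \<open>j \<in> J\<close>] by simp
  qed
  then show "corr r p q p = 0" using row_orth assms by simp
  then show "corr r p p q = 0" by (simp add: corr_def mult_ac)
qed

text \<open>For fixed \<open>p\<close> and \<open>q\<close>, the matrix \<open>corr p r q s\<close>
  in \<open>r\<close> and \<open>s\<close> is 5 times a unitary matrix: \<open>parseval\<close>
  gives one factor 5, and the unimodular factors cancel to leave an inner product of rows. The
  weight identities below come from the norms and inner products of its columns.\<close>

lemma corr_orth:
  assumes "p \<in> I" "q \<in> I" "s \<in> I" "t \<in> I"
  shows "(\<Sum>r\<in>I. corr p r q s * cnj (corr p r q t)) = (if s = t then 25 else 0)"
proof -
  have "(\<Sum>r\<in>I. corr p r q s * cnj (corr p r q t))
      = 5 * (\<Sum>j\<in>J. (h p j * cnj (h q j * h s j)) * cnj (h p j * cnj (h q j * h t j)))"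
    unfolding parseval[symmetric] corr_def by (simp add: mult_ac)
  also have "(\<Sum>j\<in>J. (h p j * cnj (h q j * h s j)) * cnj (h p j * cnj (h q j * h t j)))
      = (\<Sum>j\<in>J. h t j * cnj (h s j))"
  proof (intro sum.cong refl)
    fix j assume "j \<in> J"
    have "(h p j * cnj (h q j * h s j)) * cnj (h p j * cnj (h q j * h t j))
        = (h p j * cnj (h p j)) * (h q j * cnj (h q j)) * (h t j * cnj (h s j))"
      by (simp add: mult_ac)
    then show "(h p j * cnj (h q j * h s j)) * cnj (h p j * cnj (h q j * h t j))
        = h t j * cnj (h s j)"
      using h_cnj assms \<open>j \<in> J\<close> by simp
  qed
  also have "\<dots> = (if s = t then 5 else 0)"
    using row_orth[of t s] h_cnj assms card_J by auto
  finally show ?thesis by simp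
qed

lemma wt_total:
  assumes "p \<in> I" "q \<in> I" "s \<in> I"
  shows "(\<Sum>r\<in>I. wt p r q s) = 1"
proof -
  have "complex_of_real (wt p r q s) = corr p r q s * cnj (corr p r q s) / 25" for r
    by (simp only: wt_def of_real_divide complex_norm_square of_real_numeral)
  then have "complex_of_real (\<Sum>r\<in>I. wt p r q s) = (\<Sum>r\<in>I. corr p r q s * cnj (corr p r q s)) / 25"
    by (simp only: of_real_sum sum_divide_distrib)
  also have "\<dots> = 1" using corr_orth[of p q s s] assms by simp
  finally show ?thesis using of_real_eq_1_iff by blast
qed

text \<open>As \<open>card I = 5\<close>, such a tuple lists every row. The predicate is invariant
  under permutations, so each lemma below is available for any relabelling of the rows.\<close>

definition enum :: "'r \<Rightarrow> 'r \<Rightarrow> 'r \<Rightarrow> 'r \<Rightarrow> 'r \<Rightarrow> bool" where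
  "enum p q x y z \<longleftrightarrow> {p, q, x, y, z} \<subseteq> I \<and> distinct [p, q, x, y, z]"

lemma sum_enum:
  fixes f :: "'r \<Rightarrow> 'b :: comm_monoid_add"
  assumes "enum p q x y z"
  shows "sum f I = f p + (f q + (f x + (f y + f z)))"
proof -
  have "{p, q, x, y, z} = I"
    using assms card_I finite_I by (intro card_subset_eq) (auto simp: enum_def)
  then show ?thesis
    using assms by (auto simp: enum_def)
qed

text \<open>In the total of \<open>wt p r q x\<close> over \<open>r\<close>, the terms
  \<open>r = q\<close> and \<open>r = x\<close> vanish by \<open>corr_common\<close>, since a row is
  shared.\<close>

lemma wt_sum_distinct:
  assumes "enum p q x y z"
  shows "wt p p q x = 1 - wt q x p y - wt q x p z"
proof -
  have "p \<in> I" "q \<in> I" "x \<in> I" and d: "distinct [p, q, x, y, z]"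
    using assms by (auto simp: enum_def)
  then have "wt p q q x = 0" "wt p x q x = 0"
    using corr_common[of q x p] corr_common[of x q p] by (auto simp: wt_def)
  then show ?thesis
    using wt_total[OF \<open>p \<in> I\<close> \<open>q \<in> I\<close> \<open>x \<in> I\<close>] sum_enum[OF assms, of "\<lambda>r. wt p r q x"]
    by (simp add: wt_swap[of q x])
qed

text \<open>This is the total of \<open>wt q r p p\<close> over \<open>r\<close>, where the term
  \<open>r = p\<close> vanishes.\<close>

lemma wt_sum_square:
  assumes "enum p q x y z"
  shows "wt p p q q + wt p p q x + wt p p q y + wt p p q z = 1"
proof -
  have "p \<in> I" "q \<in> I" and d: "distinct [p, q, x, y, z]"
    using assms by (auto simp: enum_def)
  then have "wt q p p p = 0"
    using corr_common[of p p q] by (auto simp: wt_def)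
  then show ?thesis
    using wt_total[OF \<open>q \<in> I\<close> \<open>p \<in> I\<close> \<open>p \<in> I\<close>] sum_enum[OF assms, of "\<lambda>r. wt q r p p"]
    by (simp add: wt_swap[of p p])
qed

text \<open>Columns \<open>x\<close> and \<open>y\<close> of the unitary matrix are orthogonal. The
  terms \<open>r = q\<close>, \<open>r = x\<close> and \<open>r = y\<close> vanish, so those for
  \<open>r = p\<close> and \<open>r = z\<close> are opposite and have equal modulus.\<close>

lemma wt_prod:
  assumes "enum p q x y z"
  shows "wt p p q x * wt p p q y = wt p z q x * wt p z q y"
proof -
  have mem: "p \<in> I" "q \<in> I" "x \<in> I" "y \<in> I" and d: "distinct [p, q, x, y, z]"
    using assms by (auto simp: enum_def)
  then have "corr p q q x = 0" "corr p x q x = 0" "corr p y q y = 0"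
    using corr_common[of q x p] corr_common[of x q p] corr_common[of y q p] by auto
  then have "corr p p q x * cnj (corr p p q y) + corr p z q x * cnj (corr p z q y) = 0"
    using corr_orth[OF mem] d sum_enum[OF assms, of "\<lambda>r. corr p r q x * cnj (corr p r q y)"]
    by auto
  then have "norm (corr p p q x * cnj (corr p p q y)) = norm (corr p z q x * cnj (corr p z q y))"
    by (simp add: add_eq_0_iff norm_minus_cancel del: complex_cnj_mult)
  then have "(norm (corr p p q x))\<^sup>2 * (norm (corr p p q y))\<^sup>2
      = (norm (corr p z q x))\<^sup>2 * (norm (corr p z q y))\<^sup>2"
    by (simp add: norm_mult flip: power_mult_distrib)
  then show ?thesis by (simp add: wt_def)
qed

text \<open>The unordered pairs of rows with disjointness as adjacency form the Petersen graph, and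
  \<open>wt p r q s\<close> with distinct arguments is a weight on its edges.  The lemma relates the weights at the
  two ends of a path through the vertex \<open>{p, z}\<close>.\<close>

lemma wt_relation:
  assumes "enum p q x y z"
  shows "(1 - wt q x p z - wt q x p y) * (1 - wt q y p z - wt q y p x) = wt q x p z * wt q y p z"
proof -
  have "enum p q y x z" using assms by (auto simp: enum_def)
  then show ?thesis
    using wt_prod[OF assms] wt_sum_distinct[OF assms] wt_sum_distinct[of p q y x z]
    by (simp add: wt_swap[of p z] algebra_simps)
qed

text \<open>The vertex \<open>{p, z}\<close> has the three neighbours \<open>{q, x}\<close>,
  \<open>{q, y}\<close>, \<open>{x, y}\<close>; \<open>wt_relation\<close> for each two of them
  gives the system solved in \<open>half_of_relations\<close>.\<close>

lemma relations3:
  assumes "enum p q x y z"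
  shows "(1 - wt q x p z - wt q x p y) * (1 - wt q y p z - wt q y p x) = wt q x p z * wt q y p z"
    and "(1 - wt q x p z - wt q x p y) * (1 - wt x y p z - wt x y p q) = wt q x p z * wt x y p z"
    and "(1 - wt q y p z - wt q y p x) * (1 - wt x y p z - wt x y p q) = wt q y p z * wt x y p z"
proof -
  have "enum p x q y z" "enum p y q x z" using assms by (auto simp: enum_def)
  then show "(1 - wt q x p z - wt q x p y) * (1 - wt x y p z - wt x y p q) = wt q x p z * wt x y p z"
    and "(1 - wt q y p z - wt q y p x) * (1 - wt x y p z - wt x y p q) = wt q y p z * wt x y p z"
    using wt_relation[of p x q y z] wt_relation[of p y q x z]
    by (simp_all add: wt_commL[of q x] wt_commL[of q y] wt_commL[of x y])
qed (rule wt_relation[OF assms])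

text \<open>With weight 1 excluded, \<open>half_of_relations\<close> applies everywhere. For
  \<open>u = wt q x p z\<close> and \<open>v = wt q x p y\<close> it gives
  \<open>2 * u + v = 1\<close>, and exchanging \<open>y\<close> with \<open>z\<close> gives
  \<open>2 * v + u = 1\<close>.\<close>

lemma wt_third:
  assumes "enum p q x y z" and ne: "\<And>p q x y z. enum p q x y z \<Longrightarrow> wt p q x y \<noteq> 1"
  shows "wt q x p z = 1 / 3"
proof -
  have half: "2 * wt q x p z + wt q x p y = 1" if "enum p q x y z" for p q x y z
  proof -
    have "enum q x p y z" "enum q y p x z" "enum x y p q z" using that by (auto simp: enum_def)
    then show ?thesis using half_of_relations[OF relations3[OF that]] ne by blast
  qed
  have "enum p q x z y" using assms by (auto simp: enum_def)
  then show ?thesis using half[OF assms(1)] half[OF \<open>enum p q x z y\<close>] by linarith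
qed

text \<open>The case excluded in \<open>wt_third\<close>: an edge of weight 1 makes enough other
  weights vanish that \<open>wt p p q t\<close> or \<open>wt r r q t\<close> takes up the whole
  total in \<open>wt_sum_square\<close>.\<close>

lemma wt_square_zero_of_one:
  assumes e: "enum p r q s t" and "wt p r q s = 1"
  shows "wt p p q q = 0 \<or> wt r r q q = 0"
proof -
  have en: "enum q p r s t" "enum t p r s q" "enum s p r q t" "enum p q t r s" "enum r q t p s"
    using e by (auto simp: enum_def)
  have "wt q q p r = 1 - wt p r q s - wt p r q t" "wt s s p r = 1 - wt p r s q - wt p r s t"
    using wt_sum_distinct[OF en(1)] wt_sum_distinct[OF en(3)] by simp_all
  \<comment> \<open>As \<open>wt q q p r\<close> and \<open>wt s s p r\<close> are nonnegative, the
    weight 1 leaves nothing for the other two edges at \<open>{p, r}\<close>.\<close>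
  then have z: "wt p r q t = 0" "wt p r s t = 0"
    using assms(2) wt_nonneg[of q q p r] wt_nonneg[of s s p r] wt_nonneg[of p r q t]
      wt_nonneg[of p r s t] wt_commR[of p r s q] by linarith+
  note R = relations3[OF en(2)]
  have z': "wt p r t q = 0" "wt p r t s = 0"
    using z by (simp_all add: wt_commR[of p r q t] wt_commR[of p r s t])
  \<comment> \<open>The first relation at the vertex \<open>{t, q}\<close> now reduces to the
    vanishing of the left factor in the third one.\<close>
  have "wt p s t q * wt r s t q = 0"
    using R z' by simp
  then consider "wt p s t q = 0" | "wt r s t q = 0" by auto
  then show ?thesis
  proof cases
    case 1
    then have "wt p p q t = 1"
      using wt_sum_distinct[OF en(4)] z'
      by (simp add: wt_swap[of q t] wt_commR[of _ _ q t])
    then show ?thesis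
      using wt_sum_square[OF en(4)] wt_nonneg[of p p q q] wt_nonneg[of p p q r] wt_nonneg[of p p q s]
      by linarith
  next
    case 2
    then have "wt r r q t = 1"
      using wt_sum_distinct[OF en(5)] z'
      by (simp add: wt_swap[of q t] wt_commR[of _ _ q t] wt_commL[of r p])
    then show ?thesis
      using wt_sum_square[OF en(5)] wt_nonneg[of r r q q] wt_nonneg[of r r q p] wt_nonneg[of r r q s]
      by linarith
  qed
qed

lemma enum_exists: "\<exists>p q x y z. enum p q x y z"
proof -
  obtain l where l: "set l = I" "distinct l" using finite_distinct_list[OF finite_I] by blast
  then have "length l = 5" using card_I distinct_card by fastforce
  then have "\<exists>p q x y z. l = [p, q, x, y, z]"
    by (auto simp: numeral_eq_Suc length_Suc_conv)
  then obtain p q x y z where "l = [p, q, x, y, z]" by blast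
  with l have "I = set [p, q, x, y, z]" "distinct [p, q, x, y, z]" by simp_all
  then have "enum p q x y z" unfolding enum_def by simp
  then show ?thesis by blast
qed

text \<open>Either some edge has weight 1, or all edges have weight 1/3. In the second case
  \<open>wt p p q x\<close>, \<open>wt p p q y\<close> and \<open>wt p p q z\<close> are 1/3 each
  and exhaust the total in \<open>wt_sum_square\<close>.\<close>

theorem square_orth:
  "\<exists>p\<in>I. \<exists>q\<in>I. p \<noteq> q \<and> (\<Sum>j\<in>J. (h p j * cnj (h q j))\<^sup>2) = 0"
proof -
  have "\<exists>p q x y z. enum p q x y z \<and> wt p p q q = 0"
  proof (cases "\<exists>p r q s t. enum p r q s t \<and> wt p r q s = 1")
    case True
    then obtain p r q s t where e: "enum p r q s t" "wt p r q s = 1" by blast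
    have "enum p q r s t" "enum r q p s t" using e(1) by (auto simp: enum_def)
    then show ?thesis using wt_square_zero_of_one[OF e] by blast
  next
    case False
    obtain p q x y z where e: "enum p q x y z" using enum_exists by blast
    have third: "wt q x p z = 1 / 3" if "enum p q x y z" for p q x y z
      using wt_third[OF that] False by blast
    have t: "wt p p q x = 1 / 3" if e: "enum p q x y z" for p q x y z
    proof -
      have "enum p q x z y" using e by (auto simp: enum_def)
      then show ?thesis using wt_sum_distinct[OF e] third[OF e] third[of p q x z y] by simp
    qed
    have "enum p q y x z" "enum p q z x y" using e by (auto simp: enum_def)
    then have "wt p p q q = 0"
      using wt_sum_square[OF e] t[OF e] t[of p q y x z] t[of p q z x y] by simp
    then show ?thesis using e by blast
  qed
  then obtain p q x y z where e: "enum p q x y z" and "wt p p q q = 0" by blast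
  then have "corr p p q q = 0" by (simp add: wt_def)
  then have "(\<Sum>j\<in>J. (h p j * cnj (h q j))\<^sup>2) = 0"
    by (simp add: corr_def power2_eq_square mult_ac)
  then show ?thesis using e by (auto simp: enum_def)
qed

end

section \<open>Roots of unity\<close>

text \<open>The sum of \<open>(w b / w a) ^ k\<close> over \<open>k < N\<close> is \<open>N\<close>
  if \<open>w b = w a\<close> and 0 otherwise. Summing over \<open>b\<close> first leaves only
  \<open>k = 0\<close>, so the total is \<open>N\<close> and the value \<open>w a\<close> is taken
  once.\<close>

lemma inj_on_of_power_sums:
  fixes w :: "'a \<Rightarrow> complex"
  assumes "finite B" "card B = N"
    and root: "\<And>b. b \<in> B \<Longrightarrow> w b ^ N = 1"
    and sums: "\<And>k. 0 < k \<Longrightarrow> k < N \<Longrightarrow> (\<Sum>b\<in>B. w b ^ k) = 0"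
  shows "inj_on w B"
proof (rule inj_onI, rule ccontr)
  fix a c assume ac: "a \<in> B" "c \<in> B" "w a = w c" "a \<noteq> c"
  then have "N > 0" using assms(1,2) card_gt_0_iff by blast
  then have nz: "w a \<noteq> 0" using root[OF ac(1)] by (auto simp: power_0_left)
  define u where "u b = w b / w a" for b
  have uN: "u b ^ N = 1" if "b \<in> B" for b
    using root[OF that] root[OF ac(1)] by (simp add: u_def power_divide)
  have geo: "(\<Sum>k<N. u b ^ k) = (if w b = w a then of_nat N else 0)" if "b \<in> B" for b
    using geometric_sum[of "u b" N] uN[OF that] nz by (auto simp: u_def)
  have "(\<Sum>b\<in>B. \<Sum>k<N. u b ^ k) = (\<Sum>k<N. \<Sum>b\<in>B. u b ^ k)"
    by (rule sum.swap)
  also have "\<dots> = (\<Sum>k<N. if k = 0 then of_nat N else 0)"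
    using sums assms(2) by (intro sum.cong) (auto simp: u_def power_divide simp flip: sum_divide_distrib)
  also have "\<dots> = of_nat N" using \<open>N > 0\<close> by (simp add: sum.delta)
  finally have "(\<Sum>b\<in>B. if w b = w a then of_nat N else 0) = (of_nat N :: complex)"
    using geo by simp
  then have "of_nat (N * card {b \<in> B. w b = w a}) = (of_nat N :: complex)"
    using assms(1) by (simp add: sum.If_cases Int_def mult.commute)
  then have "card {b \<in> B. w b = w a} = 1"
    using \<open>N > 0\<close> by (simp only: of_nat_eq_iff) simp
  moreover have "card {a, c} \<le> card {b \<in> B. w b = w a}"
    using ac assms(1) by (intro card_mono) auto
  ultimately show False using ac by simp
qed

lemma roots2:
  fixes w :: "'a \<Rightarrow> complex"
  assumes "card B = 2" "c \<in> B" "w c = 1" "(\<Sum>b\<in>B. w b) = 0" "b \<in> B"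
  shows "w b ^ 2 = 1"
proof -
  have "card (B - {c}) = 1" using assms by simp
  then obtain x where "B - {c} = {x}" by (rule card_1_singletonE)
  then have B: "B = {c, x}" "c \<noteq> x" using assms(2) by auto
  then have "w x = - 1" using assms(3,4) by (simp add: add_eq_0_iff)
  then show ?thesis using assms(3,5) B by auto
qed

text \<open>Conjugating the vanishing sum and multiplying by \<open>w x * w y\<close> shows that the
  second elementary symmetric function vanishes too, so the three numbers, among them 1, have a
  common cube.\<close>

lemma roots3:
  fixes w :: "'a \<Rightarrow> complex"
  assumes "card B = 3" "\<And>b. b \<in> B \<Longrightarrow> norm (w b) = 1"
    and "c \<in> B" "w c = 1" "(\<Sum>b\<in>B. w b) = 0" "b \<in> B"
  shows "w b ^ 3 = 1"
proof -
  have "finite B" using assms(1) by (simp add: card_ge_0_finite)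
  then have "card (B - {c}) = 2" using assms by simp
  then obtain x y where xy: "B - {c} = {x, y}" "x \<noteq> y" by (auto simp: card_2_iff)
  then have B: "B = {c, x, y}" "c \<noteq> x" "c \<noteq> y" using assms(3) by auto
  have s: "1 + w x + w y = 0" using assms(4,5) B xy by (simp add: add_ac)
  have n: "norm (w x) = 1" "norm (w y) = 1" using assms(2) B by auto
  then have u: "w x * cnj (w x) = 1" "w y * cnj (w y) = 1" by (simp_all add: mult_cnj_unit)
  have "w x * w y + (w x * cnj (w x)) * w y + (w y * cnj (w y)) * w x
      = w x * w y * cnj (1 + w x + w y)"
    by (simp add: algebra_simps)
  then have "w x * w y + w y + w x = 0" unfolding u s by simp
  then have "w x ^ 3 = 1" "w y ^ 3 = 1" using s by algebra+
  then show ?thesis using assms(4,6) B by auto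
qed

text \<open>The hypotheses make the elementary symmetric functions \<open>e\<^sub>1\<close>, \<open>e\<^sub>2\<close> vanish; conjugation turns
  this into \<open>e\<^sub>4 = e\<^sub>3 = 0\<close>, so the five numbers are the roots of \<open>X\<^sup>5 - e\<^sub>5\<close>.\<close>

lemma roots5:
  fixes w :: "'a \<Rightarrow> complex"
  assumes "card B = 5" "\<And>b. b \<in> B \<Longrightarrow> norm (w b) = 1"
    and "c \<in> B" "w c = 1" "(\<Sum>b\<in>B. w b) = 0" "(\<Sum>b\<in>B. (w b)\<^sup>2) = 0" "b \<in> B"
  shows "w b ^ 5 = 1"
proof -
  have "finite B" using assms(1) by (simp add: card_ge_0_finite)
  then obtain l where l: "set l = B - {c}" "distinct l"
    using finite_distinct_list[of "B - {c}"] by auto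
  then have "length l = 4" using distinct_card[of l] assms(1,3) \<open>finite B\<close> by simp
  then have "\<exists>x y z u. l = [x, y, z, u]" by (auto simp: numeral_eq_Suc length_Suc_conv)
  then obtain x y z u where "l = [x, y, z, u]" by blast
  moreover have "B = insert c (set l)" using l(1) assms(3) by blast
  moreover have "distinct (c # l)" using l by simp
  ultimately have d: "distinct [c, x, y, z, u]" and B: "B = {c, x, y, z, u}" by simp_all
  have n: "norm (w x) = 1" "norm (w y) = 1" "norm (w z) = 1" "norm (w u) = 1"
    using assms(2) B by auto
  have s: "1 + w x + w y + w z + w u = 0" "1 + (w x)\<^sup>2 + (w y)\<^sup>2 + (w z)\<^sup>2 + (w u)\<^sup>2 = 0"
    using assms(4,5,6) B d by (simp_all add: add_ac)
  note unit = n[THEN mult_cnj_unit]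
  have "w x * w y * w z * w u + (w x * cnj (w x)) * (w y * w z * w u)
      + (w y * cnj (w y)) * (w x * w z * w u) + (w z * cnj (w z)) * (w x * w y * w u)
      + (w u * cnj (w u)) * (w x * w y * w z)
      = w x * w y * w z * w u * cnj (1 + w x + w y + w z + w u)"
    by (simp add: algebra_simps)
  then have e4: "w x * w y * w z * w u + w y * w z * w u + w x * w z * w u
      + w x * w y * w u + w x * w y * w z = 0"
    unfolding unit s by simp
  \<comment> \<open>Newton's identity: twice the second elementary symmetric function is the square
    of the sum minus the sum of the squares.\<close>
  have "2 * (w x + w y + w z + w u + w x * w y + w x * w z + w x * w u
        + w y * w z + w y * w u + w z * w u)
      = (1 + w x + w y + w z + w u)\<^sup>2 - (1 + (w x)\<^sup>2 + (w y)\<^sup>2 + (w z)\<^sup>2 + (w u)\<^sup>2)"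
    by algebra
  then have e2: "w x + w y + w z + w u + w x * w y + w x * w z + w x * w u
      + w y * w z + w y * w u + w z * w u = 0"
    unfolding s by (simp del: distrib_left_numeral)
  have "(w x * cnj (w x)) * (w y * w z * w u) + (w y * cnj (w y)) * (w x * w z * w u)
      + (w z * cnj (w z)) * (w x * w y * w u) + (w u * cnj (w u)) * (w x * w y * w z)
      + (w x * cnj (w x)) * (w y * cnj (w y)) * (w z * w u)
      + (w x * cnj (w x)) * (w z * cnj (w z)) * (w y * w u)
      + (w x * cnj (w x)) * (w u * cnj (w u)) * (w y * w z)
      + (w y * cnj (w y)) * (w z * cnj (w z)) * (w x * w u)
      + (w y * cnj (w y)) * (w u * cnj (w u)) * (w x * w z)
      + (w z * cnj (w z)) * (w u * cnj (w u)) * (w x * w y)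
      = w x * w y * w z * w u * cnj (w x + w y + w z + w u + w x * w y + w x * w z + w x * w u
        + w y * w z + w y * w u + w z * w u)"
    by (simp add: algebra_simps)
  then have e3: "w y * w z * w u + w x * w z * w u + w x * w y * w u + w x * w y * w z
      + w z * w u + w y * w u + w y * w z + w x * w u + w x * w z + w x * w y = 0"
    unfolding unit e2 by simp
  have e5: "t ^ 5 = w x * w y * w z * w u"
    if "(t - 1) * (t - w x) * (t - w y) * (t - w z) * (t - w u) = 0" for t
  proof -
    have expand: "(t - 1) * (t - w x) * (t - w y) * (t - w z) * (t - w u)
      = t ^ 5 - (1 + w x + w y + w z + w u) * t ^ 4
      + (w x + w y + w z + w u + w x * w y + w x * w z + w x * w u
        + w y * w z + w y * w u + w z * w u) * t ^ 3
      - (w y * w z * w u + w x * w z * w u + w x * w y * w u + w x * w y * w z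
        + w z * w u + w y * w u + w y * w z + w x * w u + w x * w z + w x * w y) * t ^ 2
      + (w x * w y * w z * w u + w y * w z * w u + w x * w z * w u
        + w x * w y * w u + w x * w y * w z) * t - w x * w y * w z * w u"
      by algebra
    show ?thesis using that unfolding expand s(1) e2 e3 e4 by simp
  qed
  \<comment> \<open>The known root 1 determines the constant term.\<close>
  have "w x * w y * w z * w u = 1" using e5[of 1] by simp
  then have "w x ^ 5 = 1" "w y ^ 5 = 1" "w z ^ 5 = 1" "w u ^ 5 = 1"
    using e5[of "w x"] e5[of "w y"] e5[of "w z"] e5[of "w u"] by simp_all
  then show ?thesis using assms(4,7) B by auto
qed

section \<open>Residues\<close>

lemma cis_eq_1_imp:
  assumes "cis (2 * pi * x) = 1"
  shows "x \<in> \<int>"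
proof -
  have "exp (\<i> * complex_of_real (2 * pi * x)) = 1" using assms by (simp add: cis_conv_exp)
  then obtain n :: int where "2 * pi * x = of_int (2 * n) * pi" by (auto simp: exp_eq_1)
  then have "x = of_int n" by simp
  then show ?thesis by simp
qed

lemma residues_of_roots:
  fixes B :: "int set" and t :: real
  assumes "prime N" "card B = N" "0 \<in> B"
    and root: "\<And>b. b \<in> B \<Longrightarrow> cis (2 * pi * (t * b)) ^ N = 1"
    and inj: "inj_on (\<lambda>b. cis (2 * pi * (t * real_of_int b))) B"
  shows "\<exists>k B\<^sub>0. complete_residue_set N B\<^sub>0 \<and> B = (\<lambda>b. int N ^ k * b) ` B\<^sub>0"
proof -
  have N: "N > 1" using assms(1) prime_gt_1_nat by blast
  have pN: "prime (int N)" using assms(1) by simp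
  have fin: "finite B" using assms(2) N by (simp add: card_ge_0_finite)
  have "\<forall>b\<in>B. \<exists>c::int. real N * (t * b) = of_int c"
  proof
    fix b assume "b \<in> B"
    have "cis (2 * pi * (real N * (t * b))) = 1"
      using root[OF \<open>b \<in> B\<close>] by (simp add: Complex.DeMoivre mult_ac)
    then show "\<exists>c::int. real N * (t * b) = of_int c"
      using cis_eq_1_imp by (auto elim: Ints_cases)
  qed
  then obtain c :: "int \<Rightarrow> int" where c: "\<And>b. b \<in> B \<Longrightarrow> real N * (t * b) = of_int (c b)"
    by (auto dest!: bchoice)
  have c0: "c 0 = 0" using c[OF assms(3)] by simp
  \<comment> \<open>Values of \<open>c\<close> congruent modulo \<open>N\<close> give phases
    \<open>t * b\<close> that differ by an integer, hence the same root of unity.\<close>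
  have c_inj: "b = b'" if "b \<in> B" "b' \<in> B" "[c b = c b'] (mod int N)" for b b'
  proof -
    obtain m where "c b = c b' + int N * m" using \<open>[c b = c b'] (mod int N)\<close>
      by (metis cong_iff_lin cong_sym)
    then have "real N * (t * b) = real N * (t * b' + of_int m)"
      using c[OF that(1)] c[OF that(2)] by (simp add: algebra_simps)
    then have "t * b = t * b' + of_int m" using N by simp
    then have "cis (2 * pi * (t * b)) = cis (2 * pi * (t * b')) * cis (2 * pi * of_int m)"
      by (simp add: cis_mult algebra_simps)
    then have "cis (2 * pi * (t * b)) = cis (2 * pi * (t * b'))" by simp
    then show ?thesis using inj that by (auto dest: inj_onD)
  qed
  have "B \<noteq> {0}" using assms(2) N by auto
  then obtain a where a: "a \<in> B" "a \<noteq> 0" using assms(3) by blast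
  have cross: "b * c a = a * c b" if "b \<in> B" for b
  proof -
    have "real_of_int (b * c a) = real_of_int (a * c b)"
      unfolding of_int_mult c[OF that, symmetric] c[OF a(1), symmetric] by simp
    then show ?thesis by (simp only: of_int_eq_iff)
  qed
  have ndvd: "\<not> int N dvd c a"
    using c_inj[OF a(1) assms(3)] a(2) c0 by (auto simp: cong_0_iff)
  then have cop: "coprime (int N) (c a)" using pN prime_imp_coprime by blast
  have "\<not> is_unit (int N)" using N by simp
  \<comment> \<open>The exponent \<open>k\<close> is read off from the single element
    \<open>a\<close>; since \<open>c a\<close> is coprime to \<open>N\<close>, the relation
    \<open>cross\<close> carries divisibility by \<open>N ^ k\<close> over to all of
    \<open>B\<close>.\<close>
  then obtain k a' where a': "a = int N ^ k * a'" "\<not> int N dvd a'"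
    using a(2) by (metis multiplicity_decompose')
  have dvd: "int N ^ k dvd b" if "b \<in> B" for b
  proof -
    have "int N ^ k dvd b * c a" using cross[OF that] a'(1) by simp
    moreover have "coprime (int N ^ k) (c a)" using cop by simp
    ultimately show ?thesis by (simp add: coprime_dvd_mult_left_iff)
  qed
  define B\<^sub>0 where "B\<^sub>0 = (\<lambda>b. b div int N ^ k) ` B"
  have eq: "int N ^ k * (b div int N ^ k) = b" if "b \<in> B" for b using dvd[OF that] by simp
  have B: "B = (\<lambda>b. int N ^ k * b) ` B\<^sub>0"
    unfolding B\<^sub>0_def image_image using eq by (simp only: image_ident cong: image_cong)
  have "inj_on (\<lambda>b. b div int N ^ k) B"
    by (rule inj_on_inverseI[where g = "\<lambda>x. int N ^ k * x"]) (rule eq)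
  then have "card B\<^sub>0 = N" using assms(2) by (simp add: B\<^sub>0_def card_image)
  moreover have "x = y" if "x \<in> B\<^sub>0" "y \<in> B\<^sub>0" "[x = y] (mod int N)" for x y
  proof -
    have mem: "int N ^ k * z \<in> B" if "z \<in> B\<^sub>0" for z
      using that by (subst B) (rule imageI)
    \<comment> \<open>This is \<open>cross\<close> with \<open>N ^ k\<close> cancelled. As
      \<open>a'\<close> is prime to \<open>N\<close>, congruent \<open>x\<close> and
      \<open>y\<close> thus lead to congruent values of \<open>c\<close>.\<close>
    have *: "z * c a = a' * c (int N ^ k * z)" if "int N ^ k * z \<in> B" for z
    proof -
      have "int N ^ k * (z * c a) = int N ^ k * (a' * c (int N ^ k * z))"
        using cross[OF that] a'(1) by (simp add: mult_ac)
      then show ?thesis using N by simp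
    qed
    have "int N dvd (x - y) * c a" using that(3) by (simp add: cong_iff_dvd_diff)
    then have "int N dvd a' * (c (int N ^ k * x) - c (int N ^ k * y))"
      unfolding left_diff_distrib right_diff_distrib using *[OF mem] that(1,2) by simp
    then have "int N dvd c (int N ^ k * x) - c (int N ^ k * y)"
      using a'(2) pN by (simp add: prime_dvd_mult_iff)
    then have "int N ^ k * x = int N ^ k * y"
      using c_inj[OF mem mem] that(1,2) by (simp add: cong_iff_dvd_diff)
    then show ?thesis using N by simp
  qed
  ultimately have "complete_residue_set N B\<^sub>0"
    using fin by (auto simp: complete_residue_set_def pairwise_def B\<^sub>0_def)
  then show ?thesis using B by blast
qed

section \<open>Orthogonal bases of exponentials\<close>

interpretation fscale: vector_space fscale
  by (rule vector_space_fscale)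

lemma sum_fun_apply: "(\<Sum>a\<in>A. f a) x = (\<Sum>a\<in>A. f a x)"
  by (induction A rule: infinite_finite_induct) auto

lemma L2_count_finite: "finite B \<Longrightarrow> L2_count B = {f. \<forall>x. x \<notin> B \<longrightarrow> f x = 0}"
  by (auto simp: L2_count_def integrable_count_space)

lemma L2_inner_finite: "finite B \<Longrightarrow> L2_inner B f g = (\<Sum>x\<in>B. f x * cnj (g x))"
  by (simp add: L2_inner_def lebesgue_integral_count_space_finite)

lemma exponential_on_cis: "x \<in> B \<Longrightarrow> exponential_on B l x = cis (2 * pi * (l * x))"
  by (simp add: exponential_on_def cis_conv_exp mult_ac)

text \<open>Expanding the point mass at \<open>y\<close> in the basis gives the coefficients
  \<open>cnj (g y) / card B\<close>. None of them is zero, so the finite subset used in the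
  expansion is all of \<open>S\<close>; evaluating the expansion at \<open>x\<close> gives the dual
  relation.\<close>

lemma orthogonal_basis_dual:
  assumes "finite B" "B \<noteq> {}" and S: "orthogonal_basis_L2 B S"
    and unit: "\<forall>f\<in>S. \<forall>x\<in>B. norm (f x) = 1"
  shows "finite S"
    and "\<And>x y. x \<in> B \<Longrightarrow> y \<in> B \<Longrightarrow>
      (\<Sum>f\<in>S. f x * cnj (f y)) = (if x = y then of_nat (card B) else 0)"
proof -
  have cB: "card B \<noteq> 0" using assms(1,2) by simp
  have orth: "(\<Sum>x\<in>B. f x * cnj (g x)) = (if f = g then of_nat (card B) else 0)"
    if "f \<in> S" "g \<in> S" for f g
  proof (cases "f = g")
    case True
    have "(\<Sum>x\<in>B. f x * cnj (g x)) = (\<Sum>x\<in>B. 1)"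
      using True unit that(1) by (intro sum.cong) (auto simp: mult_cnj_unit)
    then show ?thesis using True by simp
  next
    case False
    then show ?thesis
      using S that assms(1) by (simp add: orthogonal_basis_L2_def pairwise_def L2_inner_finite)
  qed
  have expand: "finite S \<and> (\<forall>x. (\<Sum>f\<in>S. f x * cnj (f y)) = (if x = y then of_nat (card B) else 0))"
    if "y \<in> B" for y
  proof -
    define \<delta> :: "real \<Rightarrow> complex" where "\<delta> x = (if x = y then 1 else 0)" for x
    have "\<delta> \<in> fscale.span S"
      using S assms(1) that by (auto simp: orthogonal_basis_L2_def L2_count_finite \<delta>_def)
    then obtain T r where T: "finite T" "T \<subseteq> S" and \<delta>: "\<delta> = (\<Sum>f\<in>T. fscale (r f) f)"
      by (auto simp: fscale.span_explicit)
    have \<delta>': "\<delta> x = (\<Sum>f\<in>T. r f * f x)" for x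
      by (simp add: \<delta> sum_fun_apply fscale_def)
    \<comment> \<open>The coefficient is extracted by pairing the expansion with
      \<open>g\<close>.\<close>
    have coeff: "cnj (g y) = (if g \<in> T then r g * of_nat (card B) else 0)" if "g \<in> S" for g
    proof -
      have "cnj (g y) = (\<Sum>x\<in>B. \<delta> x * cnj (g x))"
        using assms(1) \<open>y \<in> B\<close> by (simp add: \<delta>_def if_distrib[of "\<lambda>a. a * _"] cong: if_cong)
      also have "\<dots> = (\<Sum>x\<in>B. \<Sum>f\<in>T. r f * (f x * cnj (g x)))"
        by (simp add: \<delta>' sum_distrib_right mult.assoc)
      also have "\<dots> = (\<Sum>f\<in>T. \<Sum>x\<in>B. r f * (f x * cnj (g x)))"
        by (rule sum.swap)
      also have "\<dots> = (\<Sum>f\<in>T. r f * (if f = g then of_nat (card B) else 0))"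
        using T(2) that by (intro sum.cong) (auto simp: orth simp flip: sum_distrib_left)
      also have "\<dots> = (if g \<in> T then r g * of_nat (card B) else 0)"
        using T(1) by (simp add: if_distrib sum.delta cong: if_cong)
      finally show ?thesis .
    qed
    have "g \<in> T" if "g \<in> S" for g
      using coeff[OF that] unit that \<open>y \<in> B\<close> by (force split: if_splits)
    then have "S = T" using T(2) by blast
    have "(\<Sum>f\<in>S. f x * cnj (f y)) = of_nat (card B) * \<delta> x" for x
      unfolding \<delta>' sum_distrib_left using coeff \<open>S = T\<close> by (intro sum.cong) (auto simp: mult_ac)
    then show ?thesis using \<open>S = T\<close> T(1) by (simp add: \<delta>_def)
  qed
  then show "finite S" using assms(2) by blast
  show "(\<Sum>f\<in>S. f x * cnj (f y)) = (if x = y then of_nat (card B) else 0)"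
    if "x \<in> B" "y \<in> B" for x y using expand[OF that(2)] by blast
qed

lemma card_orthogonal_basis:
  assumes "finite B" "B \<noteq> {}" and S: "orthogonal_basis_L2 B S"
    and unit: "\<forall>f\<in>S. \<forall>x\<in>B. norm (f x) = 1"
  shows "card S = card B"
proof -
  obtain x where x: "x \<in> B" using assms(2) by blast
  have "of_nat (card S) = (\<Sum>f\<in>S. f x * cnj (f x))"
    using unit x by (simp add: mult_cnj_unit)
  also have "\<dots> = of_nat (card B)"
    using orthogonal_basis_dual(2)[OF assms x x] by simp
  finally show ?thesis using of_nat_eq_iff by blast
qed

section \<open>From a spectrum to roots of unity\<close>

lemma roots_of_spectral:
  fixes B :: "int set"
  assumes N: "N \<in> {2, 3, 5}" and B: "card B = N" "0 \<in> B" and "spectral (real_of_int ` B)"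
  obtains t where "\<And>b. b \<in> B \<Longrightarrow> cis (2 * pi * (t * b)) ^ N = 1"
    and "inj_on (\<lambda>b. cis (2 * pi * (t * real_of_int b))) B"
proof -
  define R where "R = real_of_int ` B"
  obtain \<Lambda> where basis: "orthogonal_basis_L2 R (exponential_on R ` \<Lambda>)"
    using assms(4) by (auto simp: spectral_def R_def)
  \<comment> \<open>Different frequencies may restrict to the same function on \<open>R\<close>, so
    the argument counts functions rather than elements of \<Lambda>.\<close>
  define S where "S = exponential_on R ` \<Lambda>"
  have fin: "finite B" using B N by (auto intro: card_ge_0_finite)
  have cR: "card R = N" "finite R" "R \<noteq> {}"
    using fin B by (auto simp: R_def card_image inj_on_def)
  have S: "orthogonal_basis_L2 R S" using basis by (simp add: S_def)
  have unit: "\<forall>f\<in>S. \<forall>x\<in>R. norm (f x) = 1"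
    by (auto simp: S_def exponential_on_cis)
  have cS: "card S = N" using card_orthogonal_basis[OF cR(2,3) S unit] cR(1) by simp
  have orth: "(\<Sum>x\<in>R. f x * cnj (g x)) = 0" if "f \<in> S" "g \<in> S" "f \<noteq> g" for f g
    using S that cR(2) by (simp add: orthogonal_basis_L2_def pairwise_def L2_inner_finite)
  have "\<exists>f\<in>S. \<exists>g\<in>S. f \<noteq> g \<and> (N = 5 \<longrightarrow> (\<Sum>x\<in>R. (f x * cnj (g x))\<^sup>2) = 0)"
  proof (cases "N = 5")
    case True
    interpret hadamard5 S R "\<lambda>f. f"
    proof
      show "card S = 5" "card R = 5" using cS cR True by simp_all
      show "(\<Sum>f\<in>S. f x * cnj (f y)) = (if x = y then 5 else 0)" if "x \<in> R" "y \<in> R" for x y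
        using orthogonal_basis_dual(2)[OF cR(2,3) S unit that] cR(1) True by simp
    qed (use unit orth in auto)
    show ?thesis using square_orth by blast
  next
    case False
    have "\<not> card S \<le> Suc 0" using cS N by auto
    moreover have "finite S" using cS N by (auto intro: card_ge_0_finite)
    ultimately show ?thesis using False card_le_Suc0_iff_eq by blast
  qed
  then obtain l m where lm: "exponential_on R l \<noteq> exponential_on R m"
      "exponential_on R l \<in> S" "exponential_on R m \<in> S"
    and sq: "N = 5 \<Longrightarrow> (\<Sum>x\<in>R. (exponential_on R l x * cnj (exponential_on R m x))\<^sup>2) = 0"
    by (auto simp: S_def)
  define w where "w b = cis (2 * pi * ((l - m) * real_of_int b))" for b
  have w: "exponential_on R l b * cnj (exponential_on R m b) = w b" if "b \<in> B" for b
    using that by (simp add: R_def exponential_on_cis w_def cis_mult cis_cnj algebra_simps)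
  have sum1: "(\<Sum>b\<in>B. w b) = 0"
    using orth[OF lm(2,3,1)] w by (simp add: R_def sum.reindex inj_on_def)
  have sum2: "(\<Sum>b\<in>B. (w b)\<^sup>2) = 0" if "N = 5"
    using sq[OF that] w by (simp add: R_def sum.reindex inj_on_def)
  have unit_w: "norm (w b) = 1" for b by (simp add: w_def)
  have w0: "w 0 = 1" by (simp add: w_def)
  have root: "w b ^ N = 1" if "b \<in> B" for b
    using N roots2[OF _ B(2) w0 sum1 that] roots3[OF _ unit_w B(2) w0 sum1 that]
      roots5[OF _ unit_w B(2) w0 sum1 sum2 that] B(1) by auto
  \<comment> \<open>For an \<open>N\<close>-th root of unity, the powers with exponents
    \<open>N - k\<close> and \<open>k\<close> are conjugate. The power sums with exponent 1, and
    also 2 if \<open>N = 5\<close>, therefore settle all exponents below \<open>N\<close>.\<close>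
  have reflect: "(\<Sum>b\<in>B. w b ^ (N - k)) = cnj (\<Sum>b\<in>B. w b ^ k)" if "k \<le> N" for k
  proof -
    have "w b ^ (N - k) = cnj (w b ^ k)" if "b \<in> B" for b
    proof -
      have "w b ^ (N - k) = w b ^ (N - k) * (w b * cnj (w b)) ^ k"
        by (simp add: mult_cnj_unit unit_w)
      also have "\<dots> = w b ^ (N - k + k) * cnj (w b ^ k)"
        by (simp add: power_mult_distrib power_add)
      finally show ?thesis using root[OF that] \<open>k \<le> N\<close> by simp
    qed
    then show ?thesis by simp
  qed
  have "(\<Sum>b\<in>B. w b ^ k) = 0" if "0 < k" "k < N" for k
  proof -
    have "N = 2 \<or> N = 3 \<or> N = 5" using N by auto
    then have "k = 1 \<or> N = 5 \<and> k = 2 \<or> N = 5 \<and> k = N - 2 \<or> k = N - 1"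
      using that by presburger
    then consider "k = 1" | "N = 5" "k = 2" | "N = 5" "k = N - 2" | "k = N - 1" by blast
    then show ?thesis
      using sum1 sum2 reflect[of 1] reflect[of 2] that N by cases auto
  qed
  then have "inj_on w B"
    using inj_on_of_power_sums[OF fin B(1)] root by blast
  then show thesis using that[of "l - m"] root by (simp add: w_def[abs_def])
qed

section \<open>A spectrum for a scaled residue system\<close>

text \<open>The frequencies \<open>j / N ^ (k + 1)\<close> with \<open>j < N\<close> turn the
  exponentials into the characters of the integers modulo \<open>N\<close>, evaluated on a system of
  representatives.\<close>

lemma spectral_of_residues:
  assumes "N > 0" and B\<^sub>0: "complete_residue_set N B\<^sub>0"
  shows "spectral (real_of_int ` (\<lambda>b. int N ^ k * b) ` B\<^sub>0)"
proof -
  define \<zeta> :: "int \<Rightarrow> complex" where "\<zeta> x = cis (2 * pi * (real_of_int x / real N))" for x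
  have \<zeta>_add: "\<zeta> (x + y) = \<zeta> x * \<zeta> y" for x y
    by (simp add: \<zeta>_def cis_mult algebra_simps add_divide_distrib)
  have \<zeta>_pow: "\<zeta> x ^ n = \<zeta> (int n * x)" for x n
    by (simp add: \<zeta>_def Complex.DeMoivre mult_ac)
  have \<zeta>_N: "\<zeta> (int N * x) = 1" for x
    using assms(1) by (simp add: \<zeta>_def)
  have \<zeta>_1: "int N dvd x" if "\<zeta> x = 1" for x
  proof -
    have "real_of_int x / real N \<in> \<int>"
      using that unfolding \<zeta>_def by (rule cis_eq_1_imp)
    then obtain m :: int where "real_of_int x / real N = of_int m" by (rule Ints_cases)
    then have "real_of_int x = real_of_int (int N * m)" using assms(1) by (simp add: field_simps)
    then show ?thesis by (simp only: of_int_eq_iff) simp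
  qed
  have \<zeta>_cnj: "\<zeta> x * cnj (\<zeta> y) = \<zeta> (x - y)" for x y
    by (simp add: \<zeta>_def cis_cnj cis_mult algebra_simps diff_divide_distrib)
  have geo: "(\<Sum>j<N. \<zeta> (int j * x)) = (if int N dvd x then of_nat N else 0)" for x
  proof (cases "\<zeta> x = 1")
    case True
    then show ?thesis using \<zeta>_1[of x] by (simp flip: \<zeta>_pow)
  next
    case False
    then have "\<not> int N dvd x" using \<zeta>_N by (auto elim!: dvdE)
    then show ?thesis
      using geometric_sum[OF False, of N] \<zeta>_N[of x] by (simp add: \<zeta>_pow)
  qed
  have fin: "finite B\<^sub>0" and card: "card B\<^sub>0 = N"
    and incong: "\<And>b b'. b \<in> B\<^sub>0 \<Longrightarrow> b' \<in> B\<^sub>0 \<Longrightarrow> int N dvd b - b' \<Longrightarrow> b = b'"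
    using B\<^sub>0 by (auto simp: complete_residue_set_def pairwise_def cong_iff_dvd_diff)
  \<comment> \<open>Orthogonality sums over the points, not over the frequencies as in
    \<open>geo\<close>; reduction modulo \<open>N\<close> maps \<open>B\<^sub>0\<close> bijectively
    onto \<open>{..<N}\<close> and so reduces one sum to the other.\<close>
  have geo': "(\<Sum>b\<in>B\<^sub>0. \<zeta> (d * b)) = 0" if "\<not> int N dvd d" for d
  proof -
    define f where "f b = nat (b mod int N)" for b
    have f: "int (f b) = b mod int N" for b using assms(1) by (simp add: f_def)
    have "inj_on f B\<^sub>0"
    proof (rule inj_onI)
      fix b b' assume "b \<in> B\<^sub>0" "b' \<in> B\<^sub>0" "f b = f b'"
      then show "b = b'" using f[of b] f[of b'] incong[of b' b] by (simp add: mod_eq_dvd_iff)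
    qed
    moreover have "f ` B\<^sub>0 = {..<N}"
    proof (rule card_subset_eq)
      show "f ` B\<^sub>0 \<subseteq> {..<N}" using assms(1) by (auto simp: f_def nat_less_iff)
      show "card (f ` B\<^sub>0) = card {..<N}" using \<open>inj_on f B\<^sub>0\<close> card by (simp add: card_image)
    qed simp
    ultimately have "bij_betw f B\<^sub>0 {..<N}" by (simp add: bij_betw_def)
    then have "(\<Sum>b\<in>B\<^sub>0. \<zeta> (int (f b) * d)) = (\<Sum>j<N. \<zeta> (int j * d))"
      by (rule sum.reindex_bij_betw)
    moreover have "\<zeta> (int (f b) * d) = \<zeta> (d * b)" for b
    proof -
      have "d * b = int (f b) * d + int N * (b div int N * d)"
        by (simp add: f algebra_simps flip: distrib_left)
      then show ?thesis by (simp add: \<zeta>_add \<zeta>_N)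
    qed
    ultimately show ?thesis using geo that by simp
  qed
  define \<iota> where "\<iota> b = real_of_int (int N ^ k * b)" for b
  define R where "R = \<iota> ` B\<^sub>0"
  have finR: "finite R" using fin by (simp add: R_def)
  have inj: "inj_on \<iota> B\<^sub>0" using assms(1) by (auto simp: \<iota>_def inj_on_def)
  \<comment> \<open>The exponent is \<open>Suc k\<close> because \<open>N ^ k\<close> cancels the
    scaling of the points and one further factor \<open>N\<close> is the order of the
    characters.\<close>
  define e where "e j = exponential_on R (real j / real N ^ Suc k)" for j :: nat
  have e: "e j (\<iota> b) = \<zeta> (int j * b)" if "b \<in> B\<^sub>0" for j b
  proof -
    have "real j / real N ^ Suc k * \<iota> b = real_of_int (int j * b) / real N"
      using assms(1) by (simp add: \<iota>_def field_simps)
    then show ?thesis using that by (simp add: e_def R_def exponential_on_cis \<zeta>_def)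
  qed
  have e0: "e j x = 0" if "x \<notin> R" for j x using that by (simp add: e_def exponential_on_def)
  have sumR: "(\<Sum>x\<in>R. F x) = (\<Sum>b\<in>B\<^sub>0. F (\<iota> b))" for F :: "real \<Rightarrow> complex"
    unfolding R_def by (simp add: sum.reindex[OF inj])
  have "orthogonal_basis_L2 R (e ` {..<N})"
    unfolding orthogonal_basis_L2_def
  proof (intro conjI)
    show sub: "e ` {..<N} \<subseteq> L2_count R" using finR e0 by (auto simp: L2_count_finite)
    have "B\<^sub>0 \<noteq> {}" using card assms(1) by auto
    then obtain b where b: "b \<in> B\<^sub>0" by blast
    have "e j (\<iota> b) \<noteq> 0" for j using e[OF b] by (simp add: \<zeta>_def)
    then have "e j \<noteq> 0" for j by (metis zero_fun_apply)
    then show "0 \<notin> e ` {..<N}" by (metis imageE)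
    show "pairwise (\<lambda>f g. L2_inner R f g = 0) (e ` {..<N})"
    proof (rule pairwise_imageI)
      fix i j assume ij: "i \<in> {..<N}" "j \<in> {..<N}" "i \<noteq> j"
      have "\<bar>int i - int j\<bar> < int N" "int i - int j \<noteq> 0" using ij by auto
      then have "\<not> int N dvd int i - int j" using dvd_imp_le_int[of "int i - int j" "int N"]
        by linarith
      then show "L2_inner R (e i) (e j) = 0"
        using finR geo'[of "int i - int j"]
        by (simp add: L2_inner_finite sumR e \<zeta>_cnj left_diff_distrib)
    qed
    show "fscale.span (e ` {..<N}) = L2_count R"
    proof
      have "fscale.subspace (L2_count R)"
        using finR by (intro fscale.subspaceI) (auto simp: L2_count_finite fscale_def)
      then show "fscale.span (e ` {..<N}) \<subseteq> L2_count R"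
        using sub by (rule fscale.span_minimal[rotated])
    next
      show "L2_count R \<subseteq> fscale.span (e ` {..<N})"
      proof
        fix f assume "f \<in> L2_count R"
        then have f0: "f x = 0" if "x \<notin> R" for x using that finR by (simp add: L2_count_finite)
        \<comment> \<open>These are the discrete Fourier coefficients of \<open>f\<close>; the
          computation below is Fourier inversion by \<open>geo\<close>.\<close>
        define c where "c j = (\<Sum>b\<in>B\<^sub>0. f (\<iota> b) * cnj (\<zeta> (int j * b))) / of_nat N" for j
        have "f x = (\<Sum>j<N. c j * e j x)" for x
        proof (cases "x \<in> R")
          case True
          then obtain a where a: "a \<in> B\<^sub>0" "x = \<iota> a" by (auto simp: R_def)
          have "(\<Sum>j<N. c j * e j x)
              = (\<Sum>j<N. \<Sum>b\<in>B\<^sub>0. f (\<iota> b) * \<zeta> (int j * (a - b)) / of_nat N)"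
            using a by (simp add: c_def e sum_distrib_right sum_divide_distrib right_diff_distrib
              flip: \<zeta>_cnj) (simp add: mult_ac)
          also have "\<dots> = (\<Sum>b\<in>B\<^sub>0. \<Sum>j<N. f (\<iota> b) * \<zeta> (int j * (a - b)) / of_nat N)"
            by (rule sum.swap)
          also have "\<dots> = (\<Sum>b\<in>B\<^sub>0. f (\<iota> b) * (if int N dvd a - b then of_nat N else 0) / of_nat N)"
            by (simp add: geo flip: sum_distrib_left sum_divide_distrib)
          also have "\<dots> = (\<Sum>b\<in>B\<^sub>0. if a = b then f (\<iota> b) else 0)"
            using incong[OF a(1)] assms(1) by (intro sum.cong) auto
          also have "\<dots> = f x" using a fin by (simp add: sum.delta')
          finally show ?thesis by simp
        qed (simp add: f0 e0)
        then have "f = (\<Sum>j<N. fscale (c j) (e j))"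
          by (simp add: fun_eq_iff sum_fun_apply fscale_def)
        also have "\<dots> \<in> fscale.span (e ` {..<N})"
          by (intro fscale.span_sum fscale.span_scale fscale.span_base) auto
        finally show "f \<in> fscale.span (e ` {..<N})" .
      qed
    qed
  qed
  moreover have "e ` {..<N} = exponential_on R ` (\<lambda>j. real j / real N ^ Suc k) ` {..<N}"
    by (simp add: e_def image_image)
  ultimately have "spectral R" using finR by (auto simp: spectral_def)
  then show ?thesis by (simp add: R_def \<iota>_def image_image)
qed

theorem corollary1p19:
  fixes N :: nat and B :: "int set"
  assumes "N \<in> {2, 3, 5}" and "card B = N" and "0 \<in> B"
  shows "spectral (real_of_int ` B) \<longleftrightarrow>
    (\<exists>(k :: nat) (B\<^sub>0 :: int set). complete_residue_set N B\<^sub>0 \<and> B = (\<lambda>b. int N ^ k * b) ` B\<^sub>0)"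
proof
  assume "spectral (real_of_int ` B)"
  then obtain t where "\<And>b. b \<in> B \<Longrightarrow> cis (2 * pi * (t * b)) ^ N = 1"
    and "inj_on (\<lambda>b. cis (2 * pi * (t * real_of_int b))) B"
    using roots_of_spectral[OF assms] by blast
  moreover have "prime N" using assms(1) by auto
  ultimately show "\<exists>k B\<^sub>0. complete_residue_set N B\<^sub>0 \<and> B = (\<lambda>b. int N ^ k * b) ` B\<^sub>0"
    using residues_of_roots assms(2,3) by blast
next
  assume "\<exists>k B\<^sub>0. complete_residue_set N B\<^sub>0 \<and> B = (\<lambda>b. int N ^ k * b) ` B\<^sub>0"
  then obtain k B\<^sub>0 where B: "complete_residue_set N B\<^sub>0" "B = (\<lambda>b. int N ^ k * b) ` B\<^sub>0"
    by blast
  have "N > 0" using assms(1) by auto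
  then show "spectral (real_of_int ` B)"
    unfolding B(2) using B(1) by (rule spectral_of_residues)
qed

end
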